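(* Let $N\ge 2$ and $K\ge 1$ be integers, let $\alpha_k,\beta_k,\delta_k>0$ for $k=1,\dots,K$, and let $x(t)$ be the inhomogeneous symmetric simple exclusion process with open boundaries on $G=\{0,1,\dots,K\}^N$ with these rates. Then for every $(x_1,\dots,x_N)\in G$ the steady probability of the state is $$p(x_1,\dots,x_N)=C\prod_{i:\,x_i\ne 0}\frac{\alpha_{x_i}}{\beta_{x_i}},$$ where the product is taken over all $i\in\{1,\dots,N\}$ such that $x_i\neq 0$, and $$C=p(0,\dots,0)=\frac{1}{\left(1+\sum_{k=1}^K\frac{\alpha_k}{\beta_k}\right)^N}.$$
   Context: The process: $x(t)=(x_1(t),\dots,x_N(t))$, $t\ge0$, is a continuous-time Markov chain with finite state space $G=\{0,1,\dots,K\}^N$. Sites are numbered $1,\dots,N$ from left to right; $x_i=0$ means that site $i$ is vacant, and $x_i=k\in\{1,\dots,K\}$ means that site $i$ is occupied by a particle of type $k$. The transitions and their rates are, for each $k=1,\dots,K$: (arrival) for $i=1$ and for $i=N$, if $x_i=0$, then $x_i$ changes to $k$ at rate $\alpha_k$ (a particle of type $k$ enters from outside); (departure) for $i=1$ and for $i=N$, if $x_i=k$, then $x_i$ changes to $0$ at rate $\beta_k$ (the particle leaves the system); (hop) for any two adjacent sites $i,j\in\{1,\dots,N\}$, $|i-j|=1$, if $x_i=k$ and $x_j=0$, then the particle in site $i$ moves to site $j$ (so $x_i$ becomes $0$ and $x_j$ becomes $k$) at rate $\delta_k$. No other transitions occur. Steady probabilities: $p(x_1,\dots,x_N)$ denotes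 the steady (limiting as $t\to\infty$, equivalently stationary) probability of the state $(x_1,\dots,x_N)\in G$ of this chain. An empty product equals $1$. *)

theory Defs imports "HOL-Probability.Probability"
begin

text \<open>In this section \<open>q x y\<close> is the rate of the jumps from \<open>x\<close> to \<open>y\<close>, for distinct states \<open>x\<close>
  and \<open>y\<close> of a finite set \<open>S\<close>; the values \<open>q x x\<close> are never used.\<close>

definition generator :: "'s set \<Rightarrow> ('s \<Rightarrow> 's \<Rightarrow> real) \<Rightarrow> 's \<Rightarrow> 's \<Rightarrow> real" where
  "generator S q x y = (if x = y then - (\<Sum>z\<in>S - {x}. q x z) else q x y)"

text \<open>\<open>P t x y\<close> is the probability of being in \<open>y\<close> at time \<open>s + t\<close> given \<open>x\<close> at time \<open>s\<close>. The last
  clause says that jumps occur at the given rates: \<open>P h x y = q x y * h + o(h)\<close> for \<open>x \<noteq> y\<close>.\<close>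

definition transition_function ::
  "'s set \<Rightarrow> ('s \<Rightarrow> 's \<Rightarrow> real) \<Rightarrow> (real \<Rightarrow> 's \<Rightarrow> 's \<Rightarrow> real) \<Rightarrow> bool" where
  "transition_function S q P \<longleftrightarrow>
     (\<forall>t\<ge>0. \<forall>x\<in>S. \<forall>y\<in>S. 0 \<le> P t x y) \<and>
     (\<forall>t\<ge>0. \<forall>x\<in>S. (\<Sum>y\<in>S. P t x y) = 1) \<and>
     (\<forall>x\<in>S. \<forall>y\<in>S. P 0 x y = of_bool (x = y)) \<and>
     (\<forall>s\<ge>0. \<forall>t\<ge>0. \<forall>x\<in>S. \<forall>y\<in>S. P (s + t) x y = (\<Sum>z\<in>S. P s x z * P t z y)) \<and>
     (\<forall>x\<in>S. \<forall>y\<in>S. ((\<lambda>h. (P h x y - of_bool (x = y)) / h) \<longlongrightarrow> generator S q x y) (at_right 0))"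

text \<open>A time-homogeneous continuous-time Markov chain, with arbitrary initial distribution. The
  Markov property is stated in product form, so that no conditioning on null events is needed. The
  definition constrains finite-dimensional distributions only; in particular, path regularity is not
  required.\<close>

definition markov_chain ::
  "'a measure \<Rightarrow> (real \<Rightarrow> 'a \<Rightarrow> 's) \<Rightarrow> 's set \<Rightarrow> ('s \<Rightarrow> 's \<Rightarrow> real) \<Rightarrow> bool" where
  "markov_chain M X S q \<longleftrightarrow>
     prob_space M \<and>
     (\<forall>t\<ge>0. X t \<in> M \<rightarrow>\<^sub>M count_space S) \<and>
     (\<exists>P. transition_function S q P \<and>
       (\<forall>n (t :: nat \<Rightarrow> real) s.
          0 \<le> t 0 \<longrightarrow> (\<forall>i\<le>n. t i \<le> t (Suc i)) \<longrightarrow> (\<forall>i\<le>Suc n. s i \<in> S) \<longrightarrow>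
          \<P>(\<omega> in M. \<forall>i\<le>Suc n. X (t i) \<omega> = s i) =
          \<P>(\<omega> in M. \<forall>i\<le>n. X (t i) \<omega> = s i) * P (t (Suc n) - t n) (s n) (s (Suc n))))"

definition steady_prob :: "'a measure \<Rightarrow> (real \<Rightarrow> 'a \<Rightarrow> 's) \<Rightarrow> 's \<Rightarrow> real" where
  "steady_prob M X x = Lim at_top (\<lambda>t. \<P>(\<omega> in M. X t \<omega> = x))"

definition stationary_distribution ::
  "'s set \<Rightarrow> ('s \<Rightarrow> 's \<Rightarrow> real) \<Rightarrow> ('s \<Rightarrow> real) \<Rightarrow> bool" where
  "stationary_distribution S q p \<longleftrightarrow>
     (\<forall>x\<in>S. 0 \<le> p x) \<and> (\<Sum>x\<in>S. p x) = 1 \<and>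
     (\<forall>y\<in>S. (\<Sum>x\<in>S. p x * generator S q x y) = 0)"

text \<open>A state \<open>(x\<^sub>1, \<dots>, x\<^sub>N)\<close> is a function on \<open>{1..N}\<close>, extended by \<open>undefined\<close> elsewhere.\<close>

definition states :: "nat \<Rightarrow> nat \<Rightarrow> (nat \<Rightarrow> nat) set" where
  "states N K = {1..N} \<rightarrow>\<^sub>E {0..K}"

definition empty_state :: "nat \<Rightarrow> nat \<Rightarrow> nat" where
  "empty_state N = (\<lambda>i\<in>{1..N}. 0)"

text \<open>The three inner sums are arrivals, departures and hops. For \<open>N \<ge> 2\<close> at most one summand is
  nonzero, since different transitions out of \<open>x\<close> lead to different states.\<close>

definition exclusion_rate ::
  "nat \<Rightarrow> nat \<Rightarrow> (nat \<Rightarrow> real) \<Rightarrow> (nat \<Rightarrow> real) \<Rightarrow> (nat \<Rightarrow> real) \<Rightarrow>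
     (nat \<Rightarrow> nat) \<Rightarrow> (nat \<Rightarrow> nat) \<Rightarrow> real" where
  "exclusion_rate N K \<alpha> \<beta> \<delta> x y =
     (\<Sum>k\<in>{1..K}.
        (\<Sum>i\<in>{1, N}. if x i = 0 \<and> y = x(i := k) then \<alpha> k else 0) +
        (\<Sum>i\<in>{1, N}. if x i = k \<and> y = x(i := 0) then \<beta> k else 0) +
        (\<Sum>i\<in>{1..N}. \<Sum>j\<in>{1..N}.
           if \<bar>int i - int j\<bar> = 1 \<and> x i = k \<and> x j = 0 \<and> y = x(i := 0, j := k)
           then \<delta> k else 0))"

end

theory Submission imports Defs
begin

text \<open>The product weights satisfy detailed balance, so they are stationary. The chain is irreducible,
  since the leftmost particle can always be moved to the left until it leaves and every jump can be
  reversed. Hence \<open>P 1\<close> has positive entries and contracts the \<open>\<ell>\<^sup>1\<close> norm of signed measures of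
  total mass zero by a factor less than one (Doeblin), which gives convergence to equilibrium and
  uniqueness.\<close>

section \<open>Finite Markov chains in continuous time\<close>

text \<open>The chain supplies a transition function known only through the semigroup law and its
  right derivative at 0. No matrix exponential or Kolmogorov equation is set up: invariance of \<pi>
  comes from many short steps, positivity from the derivative at 0 carried to longer times by the
  semigroup law. In continuous time the return probability \<open>P t x x\<close> is positive for
  every t > 0, so periodicity cannot occur and irreducibility makes \<open>P 1\<close> strictly
  positive. As the contraction acts on differences of two laws, \<open>evolve\<close> and
  \<open>l1_norm\<close> take arbitrary real functions and not only probability vectors.\<close>

definition evolve ::
  "'s set \<Rightarrow> (real \<Rightarrow> 's \<Rightarrow> 's \<Rightarrow> real) \<Rightarrow> real \<Rightarrow> ('s \<Rightarrow> real) \<Rightarrow> 's \<Rightarrow> real" where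
  "evolve S P t \<mu> y = (\<Sum>x\<in>S. \<mu> x * P t x y)"

definition l1_norm :: "'s set \<Rightarrow> ('s \<Rightarrow> real) \<Rightarrow> real" where
  "l1_norm S \<mu> = (\<Sum>x\<in>S. \<bar>\<mu> x\<bar>)"

definition jump_rel :: "'s set \<Rightarrow> ('s \<Rightarrow> 's \<Rightarrow> real) \<Rightarrow> ('s \<times> 's) set" where
  "jump_rel S q = {(x, y). x \<in> S \<and> y \<in> S \<and> x \<noteq> y \<and> 0 < q x y}"

lemma l1_norm_triangle: "l1_norm S (\<lambda>x. \<mu> x + \<nu> x) \<le> l1_norm S \<mu> + l1_norm S \<nu>"
  unfolding l1_norm_def by (simp add: sum.distrib[symmetric] sum_mono)

lemma abs_le_l1_norm:
  assumes "finite S" "x \<in> S" shows "\<bar>\<mu> x\<bar> \<le> l1_norm S \<mu>"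
  unfolding l1_norm_def using assms by (intro member_le_sum) auto

lemma l1_norm_cong: "(\<And>x. x \<in> S \<Longrightarrow> \<mu> x = \<nu> x) \<Longrightarrow> l1_norm S \<mu> = l1_norm S \<nu>"
  unfolding l1_norm_def by (intro sum.cong) auto

lemma evolve_diff:
  "evolve S P t (\<lambda>x. \<mu> x - \<nu> x) y = evolve S P t \<mu> y - evolve S P t \<nu> y"
  unfolding evolve_def by (simp add: left_diff_distrib sum_subtractf)

section \<open>Semigroup, contraction and invariance\<close>

locale finite_chain =
  fixes S :: "'s set" and q P
  assumes finite_S: "finite S" and transition: "transition_function S q P"
begin

lemma P_nonneg: "t \<ge> 0 \<Longrightarrow> x \<in> S \<Longrightarrow> y \<in> S \<Longrightarrow> 0 \<le> P t x y"
  and P_sum: "t \<ge> 0 \<Longrightarrow> x \<in> S \<Longrightarrow> (\<Sum>y\<in>S. P t x y) = 1"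
  and P_0: "x \<in> S \<Longrightarrow> y \<in> S \<Longrightarrow> P 0 x y = of_bool (x = y)"
  and P_add: "s \<ge> 0 \<Longrightarrow> t \<ge> 0 \<Longrightarrow> x \<in> S \<Longrightarrow> y \<in> S \<Longrightarrow> P (s + t) x y = (\<Sum>z\<in>S. P s x z * P t z y)"
  and P_deriv: "x \<in> S \<Longrightarrow> y \<in> S \<Longrightarrow>
    ((\<lambda>h. (P h x y - of_bool (x = y)) / h) \<longlongrightarrow> generator S q x y) (at_right 0)"
  using transition unfolding transition_function_def by blast+

lemma evolve_add:
  assumes "s \<ge> 0" "t \<ge> 0" "y \<in> S"
  shows "evolve S P (s + t) \<mu> y = evolve S P t (evolve S P s \<mu>) y"
proof -
  have "evolve S P (s + t) \<mu> y = (\<Sum>x\<in>S. \<Sum>z\<in>S. \<mu> x * (P s x z * P t z y))"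
    unfolding evolve_def using assms by (simp add: P_add sum_distrib_left)
  also have "\<dots> = (\<Sum>z\<in>S. \<Sum>x\<in>S. \<mu> x * (P s x z * P t z y))" by (rule sum.swap)
  finally show ?thesis unfolding evolve_def by (simp add: sum_distrib_right mult.assoc)
qed

lemma evolve_0: "y \<in> S \<Longrightarrow> evolve S P 0 \<mu> y = \<mu> y"
  unfolding evolve_def using finite_S by (simp add: P_0 of_bool_def if_distrib cong: if_cong)

lemma sum_evolve:
  assumes "t \<ge> 0" shows "(\<Sum>y\<in>S. evolve S P t \<mu> y) = (\<Sum>x\<in>S. \<mu> x)"
proof -
  have "(\<Sum>y\<in>S. evolve S P t \<mu> y) = (\<Sum>x\<in>S. \<Sum>y\<in>S. \<mu> x * P t x y)"
    unfolding evolve_def by (rule sum.swap)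
  then show ?thesis using assms by (simp add: sum_distrib_left[symmetric] P_sum)
qed

text \<open>Subtracting a common lower bound \<open>\<epsilon>\<close> from all entries of \<open>P t\<close> does not change its action on
  signed measures of mass zero.\<close>

lemma l1_norm_evolve_Doeblin:
  assumes t: "t \<ge> 0" and e: "\<And>x y. x \<in> S \<Longrightarrow> y \<in> S \<Longrightarrow> \<epsilon> \<le> P t x y"
    and mass: "\<epsilon> = 0 \<or> (\<Sum>x\<in>S. \<mu> x) = 0"
  shows "l1_norm S (evolve S P t \<mu>) \<le> (1 - \<epsilon> * card S) * l1_norm S \<mu>"
proof -
  have "l1_norm S (evolve S P t \<mu>) = (\<Sum>y\<in>S. \<bar>\<Sum>x\<in>S. \<mu> x * (P t x y - \<epsilon>)\<bar>)"
    unfolding l1_norm_def evolve_def using mass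
    by (auto simp: right_diff_distrib sum_subtractf sum_distrib_right[symmetric])
  also have "\<dots> \<le> (\<Sum>y\<in>S. \<Sum>x\<in>S. \<bar>\<mu> x\<bar> * (P t x y - \<epsilon>))"
  proof (intro sum_mono order_trans[OF sum_abs] )
    fix x y assume "x \<in> S" "y \<in> S"
    with e show "\<bar>\<mu> x * (P t x y - \<epsilon>)\<bar> \<le> \<bar>\<mu> x\<bar> * (P t x y - \<epsilon>)"
      by (simp add: abs_mult)
  qed
  also have "\<dots> = (\<Sum>x\<in>S. \<Sum>y\<in>S. \<bar>\<mu> x\<bar> * (P t x y - \<epsilon>))" by (rule sum.swap)
  also have "\<dots> = (\<Sum>x\<in>S. \<bar>\<mu> x\<bar> * (1 - \<epsilon> * card S))"
    using t by (simp add: sum_distrib_left[symmetric] sum_subtractf P_sum mult.commute)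
  also have "\<dots> = (1 - \<epsilon> * card S) * l1_norm S \<mu>"
    unfolding l1_norm_def by (simp add: sum_distrib_right[symmetric] mult.commute)
  finally show ?thesis .
qed

text \<open>The case \<epsilon> = 0 of the Doeblin bound, in which the mass of \<mu> is
  arbitrary.\<close>

lemma l1_norm_evolve_le: "t \<ge> 0 \<Longrightarrow> l1_norm S (evolve S P t \<mu>) \<le> l1_norm S \<mu>"
  using l1_norm_evolve_Doeblin[of t 0 \<mu>] by (simp add: P_nonneg)

text \<open>Passing through z is one nonnegative term of the Chapman-Kolmogorov sum. This bound
  carries positivity from short to long times.\<close>

lemma P_mult_le:
  assumes "s \<ge> 0" "t \<ge> 0" "x \<in> S" "y \<in> S" "z \<in> S"
  shows "P s x z * P t z y \<le> P (s + t) x y"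
  unfolding P_add[OF assms(1-4)]
  using assms finite_S by (intro member_le_sum) (auto simp: P_nonneg)

text \<open>Here contractivity gives \<open>\<parallel>\<pi> P (n h) - \<pi>\<parallel> \<le> n \<parallel>\<pi> P h - \<pi>\<parallel>\<close>, and the right side is
  \<open>n * o(h)\<close> if \<open>\<pi>\<close> is annihilated by the generator.\<close>

lemma stationary_invariant:
  assumes st: "stationary_distribution S q \<pi>" and t: "t > 0" and y: "y \<in> S"
  shows "evolve S P t \<pi> y = \<pi> y"
proof -
  define D where "D h = l1_norm S (\<lambda>y. evolve S P h \<pi> y - \<pi> y)" for h
  have D_mult: "D (real n * h) \<le> real n * D h" if h: "h \<ge> 0" for n h
  proof (induction n)
    case 0
    have "D 0 = 0" unfolding D_def l1_norm_def by (simp add: evolve_0)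
    then show ?case by simp
  next
    case (Suc n)
    \<comment> \<open>Telescoping: the old displacement evolves for one more step, which cannot
      increase its norm, and the displacement of a single step is added.\<close>
    have eq: "evolve S P (real (Suc n) * h) \<pi> y - \<pi> y =
        evolve S P h (\<lambda>y. evolve S P (real n * h) \<pi> y - \<pi> y) y + (evolve S P h \<pi> y - \<pi> y)"
      if "y \<in> S" for y
      using evolve_add[of "real n * h" h y \<pi>] h that by (simp add: evolve_diff algebra_simps)
    have "D (real (Suc n) * h) = l1_norm S (\<lambda>y.
        evolve S P h (\<lambda>y. evolve S P (real n * h) \<pi> y - \<pi> y) y + (evolve S P h \<pi> y - \<pi> y))"
      unfolding D_def by (rule l1_norm_cong) (rule eq)
    also have "\<dots> \<le> l1_norm S (evolve S P h (\<lambda>y. evolve S P (real n * h) \<pi> y - \<pi> y)) + D h"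
      unfolding D_def by (rule l1_norm_triangle)
    also have "\<dots> \<le> D (real n * h) + D h"
      using l1_norm_evolve_le[OF h] unfolding D_def by simp
    also have "\<dots> \<le> real (Suc n) * D h" using Suc by (simp add: algebra_simps)
    finally show ?case .
  qed
  have "((\<lambda>h. \<Sum>y\<in>S. \<bar>\<Sum>x\<in>S. \<pi> x * ((P h x y - of_bool (x = y)) / h)\<bar>) \<longlongrightarrow>
      (\<Sum>y\<in>S. \<bar>\<Sum>x\<in>S. \<pi> x * generator S q x y\<bar>)) (at_right 0)"
    by (intro tendsto_intros P_deriv)
  moreover have "(\<Sum>y\<in>S. \<bar>\<Sum>x\<in>S. \<pi> x * generator S q x y\<bar>) = 0"
    using st unfolding stationary_distribution_def by simp
  ultimately have lim_sum: "((\<lambda>h. \<Sum>y\<in>S. \<bar>\<Sum>x\<in>S. \<pi> x * ((P h x y - of_bool (x = y)) / h)\<bar>) \<longlongrightarrow> 0)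
      (at_right 0)" by simp
  have sum_eq: "(\<Sum>y\<in>S. \<bar>\<Sum>x\<in>S. \<pi> x * ((P h x y - of_bool (x = y)) / h)\<bar>) = D h / h" if "h > 0" for h
  proof -
    have "(\<Sum>x\<in>S. \<pi> x * ((P h x y - of_bool (x = y)) / h)) = (evolve S P h \<pi> y - \<pi> y) / h"
      if "y \<in> S" for y
    proof -
      have "(evolve S P h \<pi> y - \<pi> y) = (\<Sum>x\<in>S. \<pi> x * (P h x y - of_bool (x = y)))"
        using evolve_0[OF that, of \<pi>] that unfolding evolve_def
        by (simp add: right_diff_distrib sum_subtractf P_0)
      then show ?thesis by (simp add: sum_divide_distrib)
    qed
    then have "(\<Sum>y\<in>S. \<bar>\<Sum>x\<in>S. \<pi> x * ((P h x y - of_bool (x = y)) / h)\<bar>) =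
        (\<Sum>y\<in>S. \<bar>evolve S P h \<pi> y - \<pi> y\<bar> / h)"
      using \<open>h > 0\<close> by (intro sum.cong) simp_all
    then show ?thesis unfolding D_def l1_norm_def by (simp add: sum_divide_distrib)
  qed
  have lim: "((\<lambda>h. D h / h) \<longlongrightarrow> 0) (at_right 0)"
    by (rule Lim_transform_eventually[OF lim_sum])
      (rule eventually_mono[OF eventually_at_right_less sum_eq])
  \<comment> \<open>With h = t / (n + 1) the step is positive for every n and n + 1 steps fill the
    time t, so D t is at most (n + 1) * D h = t * (D h / h).\<close>
  have "filterlim (\<lambda>n. t / real (Suc n)) (at_right 0) sequentially"
    unfolding filterlim_at
    using t LIMSEQ_Suc[OF lim_const_over_n[of t]] by (auto intro!: always_eventually)
  from filterlim_compose[OF lim this]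
  have "(\<lambda>n. t * (D (t / real (Suc n)) / (t / real (Suc n)))) \<longlonglongrightarrow> t * 0"
    by (intro tendsto_intros)
  moreover have "D t \<le> t * (D (t / real (Suc n)) / (t / real (Suc n)))" for n
  proof -
    have "real (Suc n) * (t / real (Suc n)) = t" by simp
    then have "D t \<le> real (Suc n) * D (t / real (Suc n))"
      using D_mult[of "t / real (Suc n)" "Suc n"] t by simp
    then show ?thesis using t by (simp add: mult.commute)
  qed
  ultimately have "D t \<le> 0" by (intro LIMSEQ_le_const) auto
  then show ?thesis
    using abs_le_l1_norm[OF finite_S y, of "\<lambda>y. evolve S P t \<pi> y - \<pi> y"] unfolding D_def by simp
qed

section \<open>Strict positivity of transition probabilities\<close>

text \<open>Convergence of the difference quotient forces \<open>P h x x\<close> to tend to 1, so it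
  is positive for short times. Chaining n returns to x, each after time t / n, reaches every
  t.\<close>

lemma P_diag_pos:
  assumes x: "x \<in> S" and t: "t > 0" shows "0 < P t x x"
proof -
  have h0: "((\<lambda>h::real. h) \<longlongrightarrow> 0) (at_right 0)" by (rule tendsto_ident_at)
  have "((\<lambda>h. (P h x x - of_bool (x = x)) / h * h + 1) \<longlongrightarrow> generator S q x x * 0 + 1) (at_right 0)"
    by (intro tendsto_intros P_deriv h0 x)
  then have "eventually (\<lambda>h. 0 < (P h x x - of_bool (x = x)) / h * h + 1) (at_right 0)"
    by (rule order_tendstoD(1)) simp
  then have "eventually (\<lambda>h. 0 < P h x x) (at_right 0)"
    using eventually_at_right_less by eventually_elim auto
  then obtain b where b: "b > 0" "\<And>h. 0 < h \<Longrightarrow> h < b \<Longrightarrow> 0 < P h x x"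
    unfolding eventually_at_right_field by auto
  obtain n where n: "t / b < real n" using reals_Archimedean2 by blast
  then have npos: "real n > 0" using t b(1) by (meson divide_pos_pos less_trans)
  have h: "0 < P (t / n) x x"
    using b n npos t by (intro b(2)) (auto simp: field_simps)
  have "0 < P (real (Suc m) * (t / n)) x x" for m
  proof (induction m)
    case (Suc m)
    have "0 < P (real (Suc m) * (t / n)) x x * P (t / n) x x" using Suc h by simp
    also have "\<dots> \<le> P (real (Suc m) * (t / n) + t / n) x x"
      using t x by (intro P_mult_le) auto
    finally show ?case by (simp add: algebra_simps add_divide_distrib)
  qed (use h in simp)
  moreover obtain m where "n = Suc m" using npos by (cases n) auto
  ultimately show ?thesis by (metis npos nonzero_mult_div_cancel_left times_divide_eq_right less_irrefl)
qed

text \<open>For small h the probability of the jump is close to q x y * h, hence positive; the rest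
  of the time is filled by a return to y.\<close>

lemma P_jump_pos:
  assumes "(x, y) \<in> jump_rel S q" and t: "t > 0" shows "0 < P t x y"
proof -
  have xy: "x \<in> S" "y \<in> S" "x \<noteq> y" "0 < q x y" using assms unfolding jump_rel_def by auto
  have "eventually (\<lambda>h. 0 < (P h x y - of_bool (x = y)) / h) (at_right 0)"
    using xy by (intro order_tendstoD(1)[OF P_deriv]) (auto simp: generator_def)
  then obtain b where b: "b > 0" "\<And>h. 0 < h \<Longrightarrow> h < b \<Longrightarrow> 0 < P h x y / h"
    unfolding eventually_at_right_field using xy by auto
  define h where "h = min t b / 2"
  have h: "0 < h" "h < b" "h < t" using t b(1) unfolding h_def by auto
  then have "0 < P h x y" using b(2)[of h] by (simp add: zero_less_divide_iff)
  then have "0 < P h x y * P (t - h) y y" using P_diag_pos[of y "t - h"] xy h by simp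
  also have "\<dots> \<le> P (h + (t - h)) x y" using xy h by (intro P_mult_le) auto
  finally show ?thesis by simp
qed

text \<open>Half of the time is reserved for the last jump of the path, so the induction needs t
  arbitrary.\<close>

lemma P_pos:
  assumes "(x, y) \<in> (jump_rel S q)\<^sup>*" "x \<in> S" "t > 0" shows "0 < P t x y"
  using assms
proof (induction arbitrary: t rule: rtrancl_induct)
  case base
  then show ?case by (rule P_diag_pos)
next
  case (step y z)
  have yz: "y \<in> S" "z \<in> S" using step unfolding jump_rel_def by auto
  have "0 < P (t / 2) x y * P (t / 2) y z"
    using step P_jump_pos by (intro mult_pos_pos) auto
  also have "\<dots> \<le> P (t / 2 + t / 2) x z"
    using step yz by (intro P_mult_le) auto
  finally show ?case by simp
qed

section \<open>Geometric decay and convergence to equilibrium\<close>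

lemma evolve_tendsto_zero:
  assumes irr: "\<And>x y. x \<in> S \<Longrightarrow> y \<in> S \<Longrightarrow> (x, y) \<in> (jump_rel S q)\<^sup>*"
    and mass: "(\<Sum>x\<in>S. \<mu> x) = 0" and y: "y \<in> S"
  shows "((\<lambda>t. evolve S P t \<mu> y) \<longlongrightarrow> 0) at_top"
proof -
  \<comment> \<open>A minimum over finitely many entries, at least one because y \<in> S, so it
    inherits their positivity.\<close>
  define \<epsilon> where "\<epsilon> = Min ((\<lambda>(x, y). P 1 x y) ` (S \<times> S))"
  have fin: "finite ((\<lambda>(x, y). P 1 x y) ` (S \<times> S))" using finite_S by simp
  have e_le: "\<epsilon> \<le> P 1 x y" if "x \<in> S" "y \<in> S" for x y
    unfolding \<epsilon>_def by (rule Min_le[OF fin]) (use that in force)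
  have e_pos: "\<epsilon> > 0"
    unfolding \<epsilon>_def using fin y irr by (subst Min_gr_iff) (auto intro: P_pos)
  define c where "c = 1 - \<epsilon> * card S"
  have "card S > 0" using y finite_S card_gt_0_iff by blast
  then have c1: "c < 1" unfolding c_def using e_pos by simp
  \<comment> \<open>Row y of \<open>P 1\<close> sums to 1 and its entries are at least \<epsilon>.
    The resulting bound 0 \<le> c lets the induction multiply by c and makes c ^ n tend to
    0.\<close>
  have "\<epsilon> * card S \<le> (\<Sum>z\<in>S. P 1 y z)"
    using sum_mono[of S "\<lambda>_. \<epsilon>" "P 1 y"] e_le y by (simp add: mult.commute)
  then have c0: "0 \<le> c" unfolding c_def using P_sum[of 1 y] y by simp
  have steps: "l1_norm S (evolve S P (real n) \<mu>) \<le> c ^ n * l1_norm S \<mu>" for n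
  proof (induction n)
    case 0
    show ?case by (simp add: evolve_0 cong: l1_norm_cong)
  next
    case (Suc n)
    have "l1_norm S (evolve S P (real (Suc n)) \<mu>) =
        l1_norm S (evolve S P 1 (evolve S P (real n) \<mu>))"
      using evolve_add[of "real n" 1] by (intro l1_norm_cong) (simp add: add.commute)
    also have "\<dots> \<le> c * l1_norm S (evolve S P (real n) \<mu>)"
      unfolding c_def using e_le mass by (intro l1_norm_evolve_Doeblin) (auto simp: sum_evolve)
    also have "\<dots> \<le> c * (c ^ n * l1_norm S \<mu>)" using Suc c0 by (rule mult_left_mono)
    finally show ?case by simp
  qed
  \<comment> \<open>The norm shrinks by the factor c over each unit of time; during the fractional
    rest t - n it merely does not grow.\<close>
  have bound: "\<bar>evolve S P t \<mu> y\<bar> \<le> c ^ nat \<lfloor>t\<rfloor> * l1_norm S \<mu>" if t: "t \<ge> 0" for t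
  proof -
    define n where "n = nat \<lfloor>t\<rfloor>"
    have n: "real n \<le> t" unfolding n_def using t by simp
    have "\<bar>evolve S P t \<mu> y\<bar> \<le> l1_norm S (evolve S P t \<mu>)"
      using finite_S y by (rule abs_le_l1_norm)
    also have "\<dots> = l1_norm S (evolve S P (t - real n) (evolve S P (real n) \<mu>))"
      using evolve_add[of "real n" "t - real n"] n by (intro l1_norm_cong) simp
    also have "\<dots> \<le> l1_norm S (evolve S P (real n) \<mu>)" using n by (intro l1_norm_evolve_le) simp
    also have "\<dots> \<le> c ^ n * l1_norm S \<mu>" by (rule steps)
    finally show ?thesis unfolding n_def .
  qed
  have "(\<lambda>n. c ^ n * l1_norm S \<mu>) \<longlonglongrightarrow> 0 * l1_norm S \<mu>"
    using c0 c1 by (intro tendsto_intros LIMSEQ_power_zero) simp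
  moreover have "filterlim (\<lambda>t::real. nat \<lfloor>t\<rfloor>) sequentially at_top"
    by (intro filterlim_compose[OF filterlim_nat_sequentially] filterlim_floor_sequentially)
  ultimately have "((\<lambda>t::real. c ^ nat \<lfloor>t\<rfloor> * l1_norm S \<mu>) \<longlongrightarrow> 0) at_top"
    by (auto dest: filterlim_compose)
  then show ?thesis
    by (rule Lim_null_comparison[rotated])
      (use bound in \<open>auto intro: eventually_mono[OF eventually_ge_at_top[of 0]]\<close>)
qed

text \<open>The difference \<mu> - \<pi> has mass zero and decays, while \<pi> stays fixed.\<close>

lemma evolve_tendsto_stationary:
  assumes irr: "\<And>x y. x \<in> S \<Longrightarrow> y \<in> S \<Longrightarrow> (x, y) \<in> (jump_rel S q)\<^sup>*"
    and st: "stationary_distribution S q \<pi>" and mass: "(\<Sum>x\<in>S. \<mu> x) = 1" and y: "y \<in> S"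
  shows "((\<lambda>t. evolve S P t \<mu> y) \<longlongrightarrow> \<pi> y) at_top"
proof -
  have "(\<Sum>x\<in>S. \<mu> x - \<pi> x) = 0"
    using st mass unfolding stationary_distribution_def by (simp add: sum_subtractf)
  from tendsto_add[OF evolve_tendsto_zero[OF irr this y] tendsto_const[of "\<pi> y"]]
  have "((\<lambda>t. evolve S P t \<mu> y - evolve S P t \<pi> y + \<pi> y) \<longlongrightarrow> \<pi> y) at_top"
    by (simp add: evolve_diff)
  then show ?thesis
    by (rule Lim_transform_eventually)
      (use stationary_invariant[OF st _ y] in
        \<open>auto intro: eventually_mono[OF eventually_gt_at_top[of 0]]\<close>)
qed

text \<open>A single trajectory, started in \<pi>, converges to both distributions.\<close>

lemma stationary_unique:
  assumes irr: "\<And>x y. x \<in> S \<Longrightarrow> y \<in> S \<Longrightarrow> (x, y) \<in> (jump_rel S q)\<^sup>*"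
    and st: "stationary_distribution S q \<pi>" "stationary_distribution S q \<pi>'" and y: "y \<in> S"
  shows "\<pi> y = \<pi>' y"
proof (rule tendsto_unique[OF trivial_limit_at_top_linorder])
  show "((\<lambda>t. evolve S P t \<pi> y) \<longlongrightarrow> \<pi>' y) at_top"
    using st y unfolding stationary_distribution_def
    by (intro evolve_tendsto_stationary irr) (auto simp: stationary_distribution_def)
  show "((\<lambda>t. evolve S P t \<pi> y) \<longlongrightarrow> \<pi> y) at_top"
    using st y unfolding stationary_distribution_def
    by (intro evolve_tendsto_stationary irr) (auto simp: stationary_distribution_def)
qed

end

section \<open>Reversibility and the laws of a chain\<close>

lemma stationary_distribution_cong:
  "(\<And>x. x \<in> S \<Longrightarrow> p x = p' x) \<Longrightarrow>
    stationary_distribution S q p \<longleftrightarrow> stationary_distribution S q p'"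
  unfolding stationary_distribution_def by (simp cong: sum.cong)

text \<open>Summed over x \<noteq> y, detailed balance turns the inflow into y into the outflow from
  y, which the diagonal entry of the generator cancels.\<close>

lemma detailed_balance_stationary:
  assumes fin: "finite S" and "\<And>x. x \<in> S \<Longrightarrow> 0 \<le> \<pi> x" "(\<Sum>x\<in>S. \<pi> x) = 1"
    and db: "\<And>x y. x \<in> S \<Longrightarrow> y \<in> S \<Longrightarrow> \<pi> x * q x y = \<pi> y * q y x"
  shows "stationary_distribution S q \<pi>"
  unfolding stationary_distribution_def
proof (intro conjI ballI)
  fix y assume y: "y \<in> S"
  have "(\<Sum>x\<in>S. \<pi> x * generator S q x y) =
      \<pi> y * generator S q y y + (\<Sum>x\<in>S - {y}. \<pi> x * generator S q x y)"
    using fin y by (rule sum.remove)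
  also have "(\<Sum>x\<in>S - {y}. \<pi> x * generator S q x y) = (\<Sum>x\<in>S - {y}. \<pi> y * q y x)"
    using db y by (intro sum.cong) (auto simp: generator_def)
  finally show "(\<Sum>x\<in>S. \<pi> x * generator S q x y) = 0"
    by (simp add: generator_def sum_distrib_left)
qed (use assms in auto)

text \<open>The Markov property is used at the two times 0 and t and then summed over the initial
  state.\<close>

lemma markov_chain_marginals:
  assumes fin: "finite S" and mc: "markov_chain M X S q"
  obtains P where "transition_function S q P"
    and "(\<Sum>x\<in>S. \<P>(\<omega> in M. X 0 \<omega> = x)) = 1"
    and "\<And>t y. t \<ge> 0 \<Longrightarrow> y \<in> S \<Longrightarrow>
      \<P>(\<omega> in M. X t \<omega> = y) = evolve S P t (\<lambda>x. \<P>(\<omega> in M. X 0 \<omega> = x)) y"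
proof -
  interpret prob_space M using mc unfolding markov_chain_def by blast
  have meas: "X t \<in> M \<rightarrow>\<^sub>M count_space S" if "t \<ge> 0" for t
    using mc that unfolding markov_chain_def by blast
  obtain P where P: "transition_function S q P" and
    mp: "\<And>n (t :: nat \<Rightarrow> real) s. 0 \<le> t 0 \<Longrightarrow> (\<forall>i\<le>n. t i \<le> t (Suc i)) \<Longrightarrow>
          (\<forall>i\<le>Suc n. s i \<in> S) \<Longrightarrow>
          \<P>(\<omega> in M. \<forall>i\<le>Suc n. X (t i) \<omega> = s i) =
          \<P>(\<omega> in M. \<forall>i\<le>n. X (t i) \<omega> = s i) * P (t (Suc n) - t n) (s n) (s (Suc n))"
    using mc unfolding markov_chain_def by meson
  have X_S: "X 0 \<omega> \<in> S" if "\<omega> \<in> space M" for \<omega>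
    using measurable_space[OF meas that, of 0] by simp
  have sets: "{\<omega> \<in> space M. X t \<omega> = x} \<in> sets M" if "t \<ge> 0" for t x
  proof (cases "x \<in> S")
    case True
    have "X t -` {x} \<inter> space M \<in> sets M"
      using meas[OF that] by (rule measurable_sets) (use True in simp)
    then show ?thesis by (simp add: vimage_def Int_def conj_commute)
  next
    case False
    then have "{\<omega> \<in> space M. X t \<omega> = x} = {}"
      using measurable_space[OF meas[OF that]] by auto
    then show ?thesis by (metis sets.empty_sets)
  qed
  have joint: "\<P>(\<omega> in M. X 0 \<omega> = x \<and> X t \<omega> = y) = \<P>(\<omega> in M. X 0 \<omega> = x) * P t x y"
    if "t \<ge> 0" "x \<in> S" "y \<in> S" for t x y
    using mp[of "\<lambda>i. if i = 0 then 0 else t" 0 "\<lambda>i. if i = 0 then x else y"] that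
    by (simp add: le_Suc_eq all_conj_distrib)
  \<comment> \<open>Used twice: Q = \<open>True\<close> gives the initial mass, and the event
    \<open>X t \<omega> = y\<close> gives the law at time t.\<close>
  have partition: "\<P>(\<omega> in M. Q \<omega>) = (\<Sum>x\<in>S. \<P>(\<omega> in M. X 0 \<omega> = x \<and> Q \<omega>))"
    if Q: "{\<omega> \<in> space M. Q \<omega>} \<in> sets M" for Q
  proof -
    have s: "{\<omega> \<in> space M. X 0 \<omega> = x \<and> Q \<omega>} \<in> sets M" for x
      using sets.Int[OF sets[of 0 x] Q] by (simp add: Int_def conj_ac cong: conj_cong)
    have "{\<omega> \<in> space M. Q \<omega>} = (\<Union>x\<in>S. {\<omega> \<in> space M. X 0 \<omega> = x \<and> Q \<omega>})" using X_S by auto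
    then show ?thesis
      using s fin
      by (simp only:) (intro finite_measure_finite_Union; auto simp: disjoint_family_on_def)
  qed
  show thesis
  proof (rule that[OF P])
    show "(\<Sum>x\<in>S. \<P>(\<omega> in M. X 0 \<omega> = x)) = 1"
      using partition[of "\<lambda>_. True"] prob_space by simp
    show "\<P>(\<omega> in M. X t \<omega> = y) = evolve S P t (\<lambda>x. \<P>(\<omega> in M. X 0 \<omega> = x)) y"
      if "t \<ge> 0" "y \<in> S" for t y
      using partition[OF sets[of t y]] that by (simp add: joint evolve_def)
  qed
qed

text \<open>Convergence has to come first: \<open>steady_prob\<close> is a \<open>Lim\<close>, whose
  value is informative only for a convergent function. The third claim mentions neither M nor X, but
  its proof evolves \<pi> along the transition function of the chain.\<close>

lemma irreducible_steady_prob: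
  assumes fin: "finite S" and mc: "markov_chain M X S q"
    and irr: "\<And>x y. x \<in> S \<Longrightarrow> y \<in> S \<Longrightarrow> (x, y) \<in> (jump_rel S q)\<^sup>*"
    and st: "stationary_distribution S q \<pi>"
  shows "x \<in> S \<Longrightarrow> ((\<lambda>t. \<P>(\<omega> in M. X t \<omega> = x)) \<longlongrightarrow> \<pi> x) at_top"
    and "x \<in> S \<Longrightarrow> steady_prob M X x = \<pi> x"
    and "stationary_distribution S q p \<longleftrightarrow> (\<forall>x\<in>S. p x = \<pi> x)"
proof -
  obtain P where P: "transition_function S q P"
    and init: "(\<Sum>x\<in>S. \<P>(\<omega> in M. X 0 \<omega> = x)) = 1"
    and law: "\<And>t y. t \<ge> 0 \<Longrightarrow> y \<in> S \<Longrightarrow>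
      \<P>(\<omega> in M. X t \<omega> = y) = evolve S P t (\<lambda>x. \<P>(\<omega> in M. X 0 \<omega> = x)) y"
    using markov_chain_marginals[OF fin mc] by blast
  interpret finite_chain S q P by unfold_locales (fact fin, fact P)
  show lim: "((\<lambda>t. \<P>(\<omega> in M. X t \<omega> = x)) \<longlongrightarrow> \<pi> x) at_top" if "x \<in> S" for x
    using evolve_tendsto_stationary[OF irr st init that]
    by (rule Lim_transform_eventually)
      (use law that in \<open>auto intro: eventually_mono[OF eventually_ge_at_top[of 0]]\<close>)
  show "steady_prob M X x = \<pi> x" if "x \<in> S"
    unfolding steady_prob_def using lim[OF that]
    by (intro tendsto_Lim) simp_all
  show "stationary_distribution S q p \<longleftrightarrow> (\<forall>x\<in>S. p x = \<pi> x)"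
    using stationary_unique[OF irr _ st] stationary_distribution_cong[of S p \<pi> q] st by blast
qed

section \<open>The exclusion process\<close>

text \<open>Vacancy counts as one more type, of weight 1. Products then run over all sites and can
  be split at a site or summed by distributivity.\<close>

definition weight :: "(nat \<Rightarrow> real) \<Rightarrow> (nat \<Rightarrow> real) \<Rightarrow> nat \<Rightarrow> real" where
  "weight \<alpha> \<beta> k = (if k = 0 then 1 else \<alpha> k / \<beta> k)"

definition state_weight :: "nat \<Rightarrow> (nat \<Rightarrow> real) \<Rightarrow> (nat \<Rightarrow> real) \<Rightarrow> (nat \<Rightarrow> nat) \<Rightarrow> real" where
  "state_weight N \<alpha> \<beta> x = (\<Prod>i\<in>{1..N}. weight \<alpha> \<beta> (x i))"

lemma state_weight_eq:
  "state_weight N \<alpha> \<beta> x = (\<Prod>i\<in>{i\<in>{1..N}. x i \<noteq> 0}. \<alpha> (x i) / \<beta> (x i))"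
  unfolding state_weight_def weight_def
  by (subst prod.inter_filter) (auto intro!: prod.cong)

lemma state_weight_empty: "state_weight N \<alpha> \<beta> (empty_state N) = 1"
  unfolding state_weight_eq by (rule prod.neutral) (auto simp: empty_state_def)

text \<open>A sum of sitewise products over a product set factorises, with the same factor at each
  site. This is the origin of C.\<close>

lemma sum_state_weight:
  "(\<Sum>x\<in>states N K. state_weight N \<alpha> \<beta> x) = (1 + (\<Sum>k=1..K. \<alpha> k / \<beta> k)) ^ N"
proof -
  have "(\<Sum>x\<in>states N K. state_weight N \<alpha> \<beta> x) = (\<Prod>i\<in>{1..N}. \<Sum>k\<in>{0..K}. weight \<alpha> \<beta> k)"
    unfolding states_def state_weight_def by (subst prod_sum_PiE) auto
  also have "(\<Sum>k\<in>{0..K}. weight \<alpha> \<beta> k) = 1 + (\<Sum>k=1..K. \<alpha> k / \<beta> k)"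
    by (subst sum.atLeast_Suc_atMost) (auto simp: weight_def intro!: sum.cong)
  finally show ?thesis by simp
qed

lemma state_weight_pos:
  assumes "\<And>k. k \<in> {1..K} \<Longrightarrow> \<alpha> k > 0 \<and> \<beta> k > 0" "x \<in> states N K"
  shows "0 < state_weight N \<alpha> \<beta> x"
  unfolding state_weight_eq
proof (rule prod_pos)
  fix i assume i: "i \<in> {i \<in> {1..N}. x i \<noteq> 0}"
  then have "x i \<in> {0..K}" using assms(2) unfolding states_def by (auto dest: PiE_mem)
  with i show "0 < \<alpha> (x i) / \<beta> (x i)" using assms(1)[of "x i"] by auto
qed

lemma state_weight_upd:
  assumes "i \<in> {1..N}" "x i = 0"
  shows "state_weight N \<alpha> \<beta> (x(i := k)) = weight \<alpha> \<beta> k * state_weight N \<alpha> \<beta> x"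
proof -
  have upd: "(\<Prod>j\<in>{1..N} - {i}. weight \<alpha> \<beta> ((x(i := k)) j)) = (\<Prod>j\<in>{1..N} - {i}. weight \<alpha> \<beta> (x j))"
    by (intro prod.cong) auto
  have split: "state_weight N \<alpha> \<beta> z =
      weight \<alpha> \<beta> (z i) * (\<Prod>j\<in>{1..N} - {i}. weight \<alpha> \<beta> (z j))" for z
    unfolding state_weight_def using assms(1) by (intro prod.remove) auto
  show ?thesis unfolding split[of x] split[of "x(i := k)"] upd
    using assms(2) by (simp only: fun_upd_same) (simp add: weight_def)
qed

section \<open>Detailed balance, transition by transition\<close>

text \<open>An arrival is undone by the departure from the same site, and it multiplies the weight
  by \<alpha> k / \<beta> k, the ratio of the two rates.\<close>

lemma detailed_balance_exchange:
  assumes "i \<in> {1..N}" "k \<ge> 1" "\<beta> k \<noteq> 0"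
  shows "state_weight N \<alpha> \<beta> x * (if x i = 0 \<and> y = x(i := k) then \<alpha> k else 0) =
    state_weight N \<alpha> \<beta> y * (if y i = k \<and> x = y(i := 0) then \<beta> k else 0)"
proof -
  have "x i = 0 \<and> y = x(i := k) \<longleftrightarrow> y i = k \<and> x = y(i := 0)" by auto
  moreover have "state_weight N \<alpha> \<beta> x * \<alpha> k = state_weight N \<alpha> \<beta> y * \<beta> k"
    if "x i = 0 \<and> y = x(i := k)"
    using that assms by (simp add: state_weight_upd weight_def)
  ultimately show ?thesis by simp
qed

text \<open>A hop and its reversal have equal rates, so the weights must agree; they do, because the
  factor of a particle does not depend on its site.\<close>

lemma detailed_balance_hop:
  assumes ij: "i \<in> {1..N}" "j \<in> {1..N}"
  shows "state_weight N \<alpha> \<beta> x *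
      (if \<bar>int i - int j\<bar> = 1 \<and> x i = k \<and> x j = 0 \<and> y = x(i := 0, j := k) then d else 0) =
    state_weight N \<alpha> \<beta> y *
      (if \<bar>int j - int i\<bar> = 1 \<and> y j = k \<and> y i = 0 \<and> x = y(j := 0, i := k) then d else 0)"
proof -
  have rev: "\<bar>int j - int i\<bar> = 1 \<and> y j = k \<and> y i = 0 \<and> x = y(j := 0, i := k)"
    if "\<bar>int i - int j\<bar> = 1 \<and> x i = k \<and> x j = 0 \<and> y = x(i := 0, j := k)"
    for i j and x y :: "nat \<Rightarrow> nat"
    using that by clarify (auto simp: fun_eq_iff)
  have "\<bar>int i - int j\<bar> = 1 \<and> x i = k \<and> x j = 0 \<and> y = x(i := 0, j := k) \<longleftrightarrow>
      \<bar>int j - int i\<bar> = 1 \<and> y j = k \<and> y i = 0 \<and> x = y(j := 0, i := k)"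
    by (rule iffI[OF rev[where i = i and j = j and x = x and y = y]
          rev[where i = j and j = i and x = y and y = x]])
  moreover have "state_weight N \<alpha> \<beta> x = state_weight N \<alpha> \<beta> y"
    if h: "\<bar>int i - int j\<bar> = 1 \<and> x i = k \<and> x j = 0 \<and> y = x(i := 0, j := k)"
  proof -
    \<comment> \<open>The state without the moving particle: inserting k at i gives x, at j gives
      y.\<close>
    define z where "z = x(i := 0)"
    have "z i = 0" "z j = 0" using h by (simp_all add: z_def)
    then have "state_weight N \<alpha> \<beta> (z(i := k)) = state_weight N \<alpha> \<beta> (z(j := k))"
      by (simp only: state_weight_upd[OF ij(1)] state_weight_upd[OF ij(2)])
    moreover have "z(i := k) = x" using h by (auto simp: z_def)
    moreover have "z(j := k) = y" using h by (simp add: z_def)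
    ultimately show ?thesis by simp
  qed
  ultimately show ?thesis by simp
qed

text \<open>Balance holds for each type separately: arrivals pair with departures site by site, and
  the hop sum pairs with itself after exchanging i and j.\<close>

lemma exclusion_detailed_balance:
  assumes N: "N \<ge> 1" and b: "\<And>k. k \<in> {1..K} \<Longrightarrow> \<beta> k \<noteq> 0"
  shows "state_weight N \<alpha> \<beta> x * exclusion_rate N K \<alpha> \<beta> \<delta> x y =
    state_weight N \<alpha> \<beta> y * exclusion_rate N K \<alpha> \<beta> \<delta> y x"
  unfolding exclusion_rate_def sum_distrib_left distrib_left
proof (intro sum.cong refl)
  fix k assume k: "k \<in> {1..K}"
  let ?w = "state_weight N \<alpha> \<beta>"
  let ?A = "\<lambda>x y. \<Sum>i\<in>{1, N}. ?w x * (if x i = 0 \<and> y = x(i := k) then \<alpha> k else 0)"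
  let ?B = "\<lambda>x y. \<Sum>i\<in>{1, N}. ?w x * (if x i = k \<and> y = x(i := 0) then \<beta> k else 0)"
  let ?h = "\<lambda>x y i j. ?w x *
      (if \<bar>int i - int j\<bar> = 1 \<and> x i = k \<and> x j = 0 \<and> y = x(i := 0, j := k) then \<delta> k else 0)"
  let ?H = "\<lambda>x y. \<Sum>i\<in>{1..N}. \<Sum>j\<in>{1..N}. ?h x y i j"
  have AB: "?A x y = ?B y x" for x y
    using k b N by (intro sum.cong refl detailed_balance_exchange) auto
  have "?H x y = (\<Sum>i\<in>{1..N}. \<Sum>j\<in>{1..N}. ?h y x j i)"
    by (intro sum.cong refl detailed_balance_hop)
  also have "\<dots> = ?H y x" by (rule sum.swap)
  finally show "?A x y + ?B x y + ?H x y = ?A y x + ?B y x + ?H y x"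
    using AB[of x y] AB[of y x] by linarith
qed

section \<open>Irreducibility\<close>

text \<open>All summands are nonnegative, so one positive summand is enough. Departures and hops are
  the moves that empty the system.\<close>

lemma exclusion_rate_pos:
  assumes pos: "\<And>k. k \<in> {1..K} \<Longrightarrow> \<alpha> k > 0 \<and> \<beta> k > 0 \<and> \<delta> k > 0" and k: "k \<in> {1..K}"
  shows "i \<in> {1, N} \<Longrightarrow> x i = k \<Longrightarrow> 0 < exclusion_rate N K \<alpha> \<beta> \<delta> x (x(i := 0))"
    and "i \<in> {1..N} \<Longrightarrow> j \<in> {1..N} \<Longrightarrow> \<bar>int i - int j\<bar> = 1 \<Longrightarrow> x i = k \<Longrightarrow> x j = 0 \<Longrightarrow>
      0 < exclusion_rate N K \<alpha> \<beta> \<delta> x (x(i := 0, j := k))"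
proof -
  let ?A = "\<lambda>y k i. if x i = 0 \<and> y = x(i := k) then \<alpha> k else 0"
  let ?B = "\<lambda>y k i. if x i = k \<and> y = x(i := 0) then \<beta> k else 0"
  let ?H = "\<lambda>y k i j.
      if \<bar>int i - int j\<bar> = 1 \<and> x i = k \<and> x j = 0 \<and> y = x(i := 0, j := k) then \<delta> k else 0"
  have nn: "0 \<le> ?A y k i" "0 \<le> ?B y k i" "0 \<le> ?H y k i j" if "k \<in> {1..K}" for y k i j
    using pos[OF that] by auto
  have nn': "0 \<le> (\<Sum>i\<in>{1, N}. ?A y k i)" "0 \<le> (\<Sum>i\<in>{1, N}. ?B y k i)"
    "0 \<le> (\<Sum>i\<in>{1..N}. \<Sum>j\<in>{1..N}. ?H y k i j)" if "k \<in> {1..K}" for y k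
    by (intro sum_nonneg nn that)+
  have rate: "0 < exclusion_rate N K \<alpha> \<beta> \<delta> x y"
    if "0 < (\<Sum>i\<in>{1, N}. ?B y k i) \<or> 0 < (\<Sum>i\<in>{1..N}. \<Sum>j\<in>{1..N}. ?H y k i j)" for y
    unfolding exclusion_rate_def
  proof (rule sum_pos2[OF _ k])
    show "0 < (\<Sum>i\<in>{1, N}. ?A y k i) + (\<Sum>i\<in>{1, N}. ?B y k i) +
        (\<Sum>i\<in>{1..N}. \<Sum>j\<in>{1..N}. ?H y k i j)"
      using that nn'[OF k, of y] by linarith
  qed (intro add_nonneg_nonneg nn' | simp)+
  show "0 < exclusion_rate N K \<alpha> \<beta> \<delta> x (x(i := 0))" if "i \<in> {1, N}" "x i = k"
  proof (rule rate, rule disjI1, rule sum_pos2[OF _ that(1)])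
    show "0 < ?B (x(i := 0)) k i" using that pos[OF k] by simp
  qed (intro nn k | simp)+
  show "0 < exclusion_rate N K \<alpha> \<beta> \<delta> x (x(i := 0, j := k))"
    if "i \<in> {1..N}" "j \<in> {1..N}" "\<bar>int i - int j\<bar> = 1" "x i = k" "x j = 0"
  proof (rule rate, rule disjI2, rule sum_pos2[OF finite_atLeastAtMost that(1)],
      rule sum_pos2[OF finite_atLeastAtMost that(2)])
    show "0 < ?H (x(i := 0, j := k)) k i j" using that pos[OF k] by simp
  qed (intro nn sum_nonneg k | simp)+
qed

text \<open>The induction measure is the sum of the positions of all particles. A departure from
  site 1 and a hop to the left each lower it by one.\<close>

lemma exclusion_reaches_empty:
  assumes pos: "\<And>k. k \<in> {1..K} \<Longrightarrow> \<alpha> k > 0 \<and> \<beta> k > 0 \<and> \<delta> k > 0"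
    and x: "x \<in> states N K"
  shows "(x, empty_state N) \<in> (jump_rel (states N K) (exclusion_rate N K \<alpha> \<beta> \<delta>))\<^sup>*"
  using x
proof (induction "\<Sum>i\<in>{1..N}. if x i = 0 then 0 else i" arbitrary: x rule: less_induct)
  case less
  let ?m = "\<lambda>x::nat \<Rightarrow> nat. \<Sum>i\<in>{1..N}. if x i = 0 then 0 else i"
  let ?R = "jump_rel (states N K) (exclusion_rate N K \<alpha> \<beta> \<delta>)"
  show ?case
  proof (cases "\<exists>i. i \<in> {1..N} \<and> x i \<noteq> 0")
    case False
    then have "x = empty_state N"
      using less.prems unfolding states_def empty_state_def
      by (auto simp: fun_eq_iff restrict_def PiE_def extensional_def)
    then show ?thesis by simp
  next
    case True
    \<comment> \<open>The leftmost particle: its left neighbour, if there is one, is vacant.\<close>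
    define i where "i = (LEAST i. i \<in> {1..N} \<and> x i \<noteq> 0)"
    have i: "i \<in> {1..N}" "x i \<noteq> 0" using LeastI_ex[OF True] unfolding i_def by auto
    have left: "x j = 0" if "j \<in> {1..N}" "j < i" for j
      using not_less_Least[of j "\<lambda>i. i \<in> {1..N} \<and> x i \<noteq> 0"] that unfolding i_def by auto
    define k where "k = x i"
    have k: "k \<in> {1..K}" using i less.prems unfolding k_def states_def by (force dest: PiE_mem)
    have split: "?m z = (if z i = 0 then 0 else i) + (\<Sum>j\<in>{1..N} - {i}. if z j = 0 then 0 else j)" for z
      using i by (intro sum.remove) auto
    have "\<exists>y. (x, y) \<in> ?R \<and> ?m y < ?m x"
    proof (cases "i = 1")
      case True
      let ?y = "x(i := 0)"
      have "?y \<in> states N K" using less.prems i unfolding states_def by (auto simp: PiE_def extensional_def)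
      moreover have "?y \<noteq> x" using i by (metis fun_upd_same)
      moreover have "0 < exclusion_rate N K \<alpha> \<beta> \<delta> x ?y"
        using True k by (intro exclusion_rate_pos(1)[OF pos k]) (auto simp: k_def)
      moreover have "?m ?y < ?m x"
      proof -
        have "(\<Sum>j\<in>{1..N} - {i}. if ?y j = 0 then 0 else j) = (\<Sum>j\<in>{1..N} - {i}. if x j = 0 then 0 else j)"
          by (intro sum.cong) auto
        then show ?thesis using i unfolding split by simp
      qed
      ultimately show ?thesis
        using less.prems by (intro exI[of _ ?y] conjI) (simp_all only: jump_rel_def, simp)
    next
      case False
      obtain j where "i = Suc j" using i(1) by (cases i) auto
      then have j: "j \<in> {1..N}" "i = Suc j" using i(1) False by auto
      have xj: "x j = 0" using left j by simp
      let ?y = "x(i := 0, j := k)"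
      have "?y \<in> states N K"
        using less.prems i j k unfolding states_def by (auto simp: PiE_def extensional_def)
      moreover have "?y \<noteq> x" using k xj by (metis fun_upd_same atLeastAtMost_iff not_one_le_zero)
      moreover have "0 < exclusion_rate N K \<alpha> \<beta> \<delta> x ?y"
        using i j xj by (intro exclusion_rate_pos(2)[OF pos k]) (auto simp: k_def)
      moreover have "?m ?y < ?m x"
      proof -
        have split2: "(\<Sum>l\<in>{1..N} - {i}. if z l = 0 then 0 else l) =
            (if z j = 0 then 0 else j) + (\<Sum>l\<in>{1..N} - {i} - {j}. if z l = 0 then 0 else l)" for z :: "nat \<Rightarrow> nat"
          using j by (intro sum.remove) auto
        have "(\<Sum>l\<in>{1..N} - {i} - {j}. if ?y l = 0 then 0 else l) =
            (\<Sum>l\<in>{1..N} - {i} - {j}. if x l = 0 then 0 else l)"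
          by (intro sum.cong) auto
        then show ?thesis using i j xj k unfolding split split2 by simp
      qed
      ultimately show ?thesis
        using less.prems by (intro exI[of _ ?y] conjI) (simp_all only: jump_rel_def, simp)
    qed
    then obtain y where y: "(x, y) \<in> ?R" "?m y < ?m x" by blast
    then have "(y, empty_state N) \<in> ?R\<^sup>*" using less.hyps unfolding jump_rel_def by blast
    with y(1) show ?thesis by (rule converse_rtrancl_into_rtrancl)
  qed
qed

lemma exclusion_irreducible:
  assumes N: "N \<ge> 1"
    and pos: "\<And>k. k \<in> {1..K} \<Longrightarrow> \<alpha> k > 0 \<and> \<beta> k > 0 \<and> \<delta> k > 0"
    and x: "x \<in> states N K" and y: "y \<in> states N K"
  shows "(x, y) \<in> (jump_rel (states N K) (exclusion_rate N K \<alpha> \<beta> \<delta>))\<^sup>*"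
proof -
  let ?R = "jump_rel (states N K) (exclusion_rate N K \<alpha> \<beta> \<delta>)"
  \<comment> \<open>As all weights are positive, detailed balance transfers positivity of a rate to
    the reverse rate.\<close>
  have "sym ?R"
  proof (rule symI)
    fix x y assume "(x, y) \<in> ?R"
    then have xy: "x \<in> states N K" "y \<in> states N K" "x \<noteq> y" "0 < exclusion_rate N K \<alpha> \<beta> \<delta> x y"
      unfolding jump_rel_def by auto
    have w: "0 < state_weight N \<alpha> \<beta> z" if "z \<in> states N K" for z
      using pos that by (intro state_weight_pos) auto
    have "0 < state_weight N \<alpha> \<beta> x * exclusion_rate N K \<alpha> \<beta> \<delta> x y" using w xy by simp
    also have "\<dots> = state_weight N \<alpha> \<beta> y * exclusion_rate N K \<alpha> \<beta> \<delta> y x"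
      using pos by (intro exclusion_detailed_balance N) force
    finally show "(y, x) \<in> ?R"
      using xy w[of y] unfolding jump_rel_def by (simp add: zero_less_mult_iff)
  qed
  then have "(empty_state N, y) \<in> ?R\<^sup>*"
    using exclusion_reaches_empty[OF pos y] by (meson sym_rtrancl symD)
  with exclusion_reaches_empty[OF pos x] show ?thesis by (rule rtrancl_trans)
qed

theorem theorem2:
  fixes N K :: nat and \<alpha> \<beta> \<delta> :: "nat \<Rightarrow> real"
    and M :: "'a measure" and X :: "real \<Rightarrow> 'a \<Rightarrow> nat \<Rightarrow> nat"
  assumes "N \<ge> 2" and "K \<ge> 1"
    and "\<And>k. k \<in> {1..K} \<Longrightarrow> \<alpha> k > 0 \<and> \<beta> k > 0 \<and> \<delta> k > 0"
    and "markov_chain M X (states N K) (exclusion_rate N K \<alpha> \<beta> \<delta>)"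
  shows "(\<forall>x\<in>states N K.
            ((\<lambda>t. \<P>(\<omega> in M. X t \<omega> = x)) \<longlongrightarrow> steady_prob M X x) at_top) \<and>
         (\<forall>p. stationary_distribution (states N K) (exclusion_rate N K \<alpha> \<beta> \<delta>) p \<longleftrightarrow>
            (\<forall>x\<in>states N K. p x = steady_prob M X x)) \<and>
         (\<forall>x\<in>states N K. steady_prob M X x =
            steady_prob M X (empty_state N) * (\<Prod>i\<in>{i\<in>{1..N}. x i \<noteq> 0}. \<alpha> (x i) / \<beta> (x i))) \<and>
         steady_prob M X (empty_state N) = 1 / (1 + (\<Sum>k=1..K. \<alpha> k / \<beta> k)) ^ N"
proof -
  let ?S = "states N K" and ?q = "exclusion_rate N K \<alpha> \<beta> \<delta>"
  define Z where "Z = (1 + (\<Sum>k=1..K. \<alpha> k / \<beta> k)) ^ N"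
  define \<pi> where "\<pi> x = state_weight N \<alpha> \<beta> x / Z" for x
  have N: "N \<ge> 1" using assms(1) by simp
  have b: "\<beta> k \<noteq> 0" if "k \<in> {1..K}" for k using assms(3)[OF that] by simp
  have fin: "finite ?S" unfolding states_def by (simp add: finite_PiE)
  have "0 \<le> (\<Sum>k=1..K. \<alpha> k / \<beta> k)" using assms(3) by (intro sum_nonneg) (simp add: less_imp_le)
  then have Z: "Z > 0" unfolding Z_def by simp
  have st: "stationary_distribution ?S ?q \<pi>"
  proof (rule detailed_balance_stationary[OF fin])
    show "0 \<le> \<pi> x" if "x \<in> ?S" for x
      using state_weight_pos[of K \<alpha> \<beta> x N] assms(3) Z that unfolding \<pi>_def by auto
    show "(\<Sum>x\<in>?S. \<pi> x) = 1"
      unfolding \<pi>_def sum_divide_distrib[symmetric] sum_state_weight Z_def[symmetric]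
      using Z by simp
    show "\<pi> x * ?q x y = \<pi> y * ?q y x" for x y
      using exclusion_detailed_balance[OF N b, where \<alpha> = \<alpha> and x = x and \<delta> = \<delta> and y = y] unfolding \<pi>_def by simp
  qed
  note steady = irreducible_steady_prob[OF fin assms(4) exclusion_irreducible[OF N assms(3)] st]
  have empty: "empty_state N \<in> ?S" unfolding empty_state_def states_def by auto
  \<comment> \<open>Steady probabilities are values of \<pi>; the empty state has weight 1, so C = 1
    / Z.\<close>
  show ?thesis
    using steady empty state_weight_empty[of N \<alpha> \<beta>]
    by (simp add: \<pi>_def Z_def state_weight_eq)
qed

end
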